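(* Let $n\ge 1$, let $A \in \mathbb{R}^{2n \times 2n}$ and let $\mathbf{B}=(x_1, \ldots , x_n)$ be a basis of some Lagrangian subspace $\mathcal{L} \subset \mathbb{R}^{2n}$. Let $X_L = [\,x_1 \; \cdots \; x_{n-1}\,]$, $X_R = [\,x_2 \; \cdots \; x_n\,]$ in $\mathbb{R}^{2n\times(n-1)}$, let $\widehat{H} := X_RX_L^+ + J_{2n}^T(X_RX_L^+)^TJ_{2n}\in \mathbb{R}^{2n \times 2n}$, and let $X_L^{\bot} \in \mathbb{R}^{2n \times (n+1)}$ be a matrix whose columns are an orthonormal basis of the (Euclidean) orthogonal complement $\textnormal{span} \lbrace x_1, \ldots , x_{n-1} \rbrace^{\bot}$. Then $$ \Vert H - A \Vert_F \leq \Vert H' - A \Vert_F \quad \text{for all } H' \in \mathbb{HK}(\mathbf{B})$$ if $H = \widehat{H} + J_{2n}^TX_L^{\bot} S (X_L^{\bot})^T$ with $$S = - \frac{1}{2} \left( (X_L^{\bot})^TJ_{2n}(\widehat{H}-A)X_L^{\bot} + (X_L^{\bot})^T(\widehat{H}-A)^TJ_{2n}X_L^{\bot} \right).$$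
   Context: $J_{2n} = \begin{bmatrix} 0 & I_n \\ -I_n & 0 \end{bmatrix} \in \mathbb{R}^{2n\times 2n}$. A subspace $\mathcal{L}\subset\mathbb{R}^{2n}$ is called isotropic if $x^TJ_{2n}y = 0$ for all $x,y\in\mathcal{L}$, and Lagrangian if it is isotropic and of dimension $n$. A matrix $H\in\mathbb{R}^{2n\times 2n}$ is called skew-Hamiltonian if $J_{2n}^TH^TJ_{2n} = H$. For an ordered basis $\mathbf{B}=(x_1,\ldots,x_n)$ of a Lagrangian subspace, $\mathbb{HK}(\mathbf{B})$ denotes the set of all skew-Hamiltonian matrices $H\in\mathbb{R}^{2n\times 2n}$ satisfying $Hx_k = x_{k+1}$ for all $k=1,\ldots,n-1$. $A^+$ denotes the Moore-Penrose pseudoinverse of $A$ and $\Vert\cdot\Vert_F$ the Frobenius norm. (For $n=1$ the matrices $X_L,X_R$ have no columns and $X_RX_L^+$ is the zero matrix.) *)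

theory Defs
  imports Complex_Main "Jordan_Normal_Form.VS_Connect"
begin

text \<open>
  Vectors and matrices are the carrier-based ones, with 0-based indices, so that \<open>2 * n\<close>,
  \<open>n - 1\<close> and \<open>n + 1\<close> can occur as dimensions (including matrices with no columns).
\<close>

abbreviation vs_on :: "nat \<Rightarrow> real vec set \<Rightarrow> (real, real vec) module" where
  "vs_on m W \<equiv> module_vec TYPE(real) m \<lparr>carrier := W\<rparr>"

definition is_subspace :: "nat \<Rightarrow> real vec set \<Rightarrow> bool" where
  "is_subspace m W \<longleftrightarrow> VectorSpace.subspace class_ring W (module_vec TYPE(real) m)"

definition subspace_dim :: "nat \<Rightarrow> real vec set \<Rightarrow> nat" where
  "subspace_dim m W = vectorspace.dim class_ring (vs_on m W)"

definition vec_span :: "nat \<Rightarrow> real vec set \<Rightarrow> real vec set" where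
  "vec_span m X = LinearCombinations.module.span class_ring (module_vec TYPE(real) m) X"

definition ordered_basis :: "nat \<Rightarrow> real vec set \<Rightarrow> real vec list \<Rightarrow> bool" where
  "ordered_basis m W xs \<longleftrightarrow>
     distinct xs \<and> vectorspace.basis class_ring (vs_on m W) (set xs)"

definition orthonormal_basis :: "nat \<Rightarrow> real vec set \<Rightarrow> real vec list \<Rightarrow> bool" where
  "orthonormal_basis m W vs \<longleftrightarrow> ordered_basis m W vs \<and>
     (\<forall>i < length vs. \<forall>j < length vs. vs ! i \<bullet> vs ! j = (if i = j then 1 else 0))"

definition J :: "nat \<Rightarrow> real mat" where
  "J n = four_block_mat (0\<^sub>m n n) (1\<^sub>m n) (- (1\<^sub>m n)) (0\<^sub>m n n)"

definition isotropic :: "nat \<Rightarrow> real vec set \<Rightarrow> bool" where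
  "isotropic n L \<longleftrightarrow> is_subspace (2 * n) L \<and> (\<forall>x\<in>L. \<forall>y\<in>L. x \<bullet> (J n *\<^sub>v y) = 0)"

definition lagrangian :: "nat \<Rightarrow> real vec set \<Rightarrow> bool" where
  "lagrangian n L \<longleftrightarrow> isotropic n L \<and> subspace_dim (2 * n) L = n"

definition skew_hamiltonian :: "nat \<Rightarrow> real mat \<Rightarrow> bool" where
  "skew_hamiltonian n H \<longleftrightarrow>
     H \<in> carrier_mat (2 * n) (2 * n) \<and> (J n)\<^sup>T * H\<^sup>T * J n = H"

definition HK :: "nat \<Rightarrow> real vec list \<Rightarrow> real mat set" where
  "HK n xs = {H. skew_hamiltonian n H \<and>
     (\<forall>k. Suc k < length xs \<longrightarrow> H *\<^sub>v (xs ! k) = xs ! Suc k)}"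

definition frobenius_norm :: "real mat \<Rightarrow> real" where
  "frobenius_norm M = sqrt (\<Sum>i<dim_row M. \<Sum>j<dim_col M. (M $$ (i, j))\<^sup>2)"

text \<open>
  The Moore-Penrose pseudoinverse is the matrix given by the four Penrose conditions;
  every real matrix has exactly one.
\<close>

definition is_pinv :: "real mat \<Rightarrow> real mat \<Rightarrow> bool" where
  "is_pinv M P \<longleftrightarrow> P \<in> carrier_mat (dim_col M) (dim_row M) \<and>
     M * P * M = M \<and> P * M * P = P \<and> (M * P)\<^sup>T = M * P \<and> (P * M)\<^sup>T = P * M"

definition pinv :: "real mat \<Rightarrow> real mat" where
  "pinv M = (THE P. is_pinv M P)"

lemma is_pinv_unique:
  assumes P: "is_pinv M P" and Q: "is_pinv M Q"
  shows "P = Q"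
proof -
  define r c where "r = dim_row M" and "c = dim_col M"
  have M: "M \<in> carrier_mat r c" and Pc: "P \<in> carrier_mat c r" and Qc: "Q \<in> carrier_mat c r"
    using P Q by (auto simp: r_def c_def is_pinv_def)
  note p = P[unfolded is_pinv_def] and q = Q[unfolded is_pinv_def]
  have assoc: "\<And>A B C. A \<in> carrier_mat a b \<Longrightarrow> B \<in> carrier_mat b d \<Longrightarrow> C \<in> carrier_mat d e
      \<Longrightarrow> A * (B * C) = A * B * (C :: real mat)" for a b d e
    by (simp add: assoc_mult_mat)
  have MP: "M * P \<in> carrier_mat r r" and MQ: "M * Q \<in> carrier_mat r r"
    and PM: "P * M \<in> carrier_mat c c" and QM: "Q * M \<in> carrier_mat c c"
    using M Pc Qc by auto
  have 1: "M * P = M * Q"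
  proof -
    have "M * P = (M * Q * M) * P" using q by simp
    also have "\<dots> = (M * Q) * (M * P)" using assoc[OF MQ M Pc] by simp
    also have "\<dots> = (M * Q)\<^sup>T * (M * P)\<^sup>T" using p q by simp
    also have "\<dots> = ((M * P) * (M * Q))\<^sup>T" using transpose_mult[OF MP MQ] by simp
    also have "(M * P) * (M * Q) = M * Q" using assoc[OF MP M Qc] p by simp
    finally show ?thesis using q by simp
  qed
  have 2: "P * M = Q * M"
  proof -
    have "P * M = P * (M * (Q * M))" using q assoc[OF M Qc M] by simp
    also have "\<dots> = (P * M) * (Q * M)" using assoc[OF Pc M QM] by simp
    also have "\<dots> = (P * M)\<^sup>T * (Q * M)\<^sup>T" using p q by simp
    also have "\<dots> = ((Q * M) * (P * M))\<^sup>T" using transpose_mult[OF QM PM] by simp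
    also have "(Q * M) * (P * M) = Q * (M * P * M)"
      using assoc[OF Qc M PM] assoc[OF M Pc M] by simp
    finally show ?thesis using p q by simp
  qed
  have "P = P * M * P" using p by simp
  also have "\<dots> = Q * (M * P)" using 2 assoc[OF Qc M Pc] by simp
  also have "\<dots> = Q * M * Q" using 1 assoc[OF Qc M Qc] by simp
  finally show ?thesis using q by simp
qed

lemma pinv_eqI: "is_pinv M P \<Longrightarrow> pinv M = P"
  unfolding pinv_def using is_pinv_unique by blast

end

theory Submission
  imports Defs "Jordan_Normal_Form.DL_Rank"
begin

text \<open>
  Write $E = H - A$, $F = H' - H$ and $K = J(H' - \widehat H)$. The matrix $K$ is skew-symmetric and
  annihilates $X_L$. Since $QQ^T = I - X_L X_L^+$, this forces $K = QTQ^T$ with $T$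
  skew-symmetric, and therefore $JF = Q(T - S)Q^T$. On the other hand $S$ is minus the skew part of
  $Q^T J(\widehat H - A)Q$, so $Q^T J E Q$ is symmetric. As $J$ is orthogonal,
  $\langle F, E\rangle = \langle T - S, Q^T J E Q\rangle = 0$, and the claim is Pythagoras.
\<close>

section \<open>The Frobenius inner product\<close>

text \<open>The trace of \<open>A\<^sup>T * B\<close>, written entrywise. The index ranges come from
  \<open>A\<close> alone, so it is meaningful only for matrices of equal dimensions.\<close>

definition mat_inner :: "real mat \<Rightarrow> real mat \<Rightarrow> real" where
  "mat_inner A B = (\<Sum>i<dim_row A. \<Sum>j<dim_col A. A $$ (i, j) * B $$ (i, j))"

lemma frobenius_norm_eq: "frobenius_norm A = sqrt (mat_inner A A)"
  by (simp add: frobenius_norm_def mat_inner_def power2_eq_square)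

lemma mat_inner_self_nonneg: "mat_inner A A \<ge> 0"
  by (simp add: mat_inner_def sum_nonneg)

lemma mat_inner_transpose:
  assumes "A \<in> carrier_mat r c" "B \<in> carrier_mat r c"
  shows "mat_inner A\<^sup>T B\<^sup>T = mat_inner A B"
  using assms by (auto simp: mat_inner_def intro: sum.swap)

text \<open>Adjointness: after expanding the products, both sides are the same triple sum, and only
  the order of summation has to change.\<close>

lemma mat_inner_mult_left:
  assumes "A \<in> carrier_mat a b" "B \<in> carrier_mat b c" "C \<in> carrier_mat a c"
  shows "mat_inner (A * B) C = mat_inner B (A\<^sup>T * C)"
proof -
  have "mat_inner (A * B) C = (\<Sum>i<a. \<Sum>j<c. \<Sum>k<b. A $$ (i, k) * B $$ (k, j) * C $$ (i, j))"
    using assms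
    by (auto simp: mat_inner_def scalar_prod_def sum_distrib_right atLeast0LessThan intro!: sum.cong)
  also have "\<dots> = (\<Sum>i<a. \<Sum>k<b. \<Sum>j<c. A $$ (i, k) * B $$ (k, j) * C $$ (i, j))"
    by (intro sum.cong refl sum.swap)
  also have "\<dots> = (\<Sum>k<b. \<Sum>i<a. \<Sum>j<c. A $$ (i, k) * B $$ (k, j) * C $$ (i, j))"
    by (rule sum.swap)
  also have "\<dots> = (\<Sum>k<b. \<Sum>j<c. \<Sum>i<a. A $$ (i, k) * B $$ (k, j) * C $$ (i, j))"
    by (intro sum.cong refl sum.swap)
  also have "\<dots> = mat_inner B (A\<^sup>T * C)"
    using assms
    by (auto simp: mat_inner_def scalar_prod_def sum_distrib_left atLeast0LessThan
        algebra_simps intro!: sum.cong)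
  finally show ?thesis .
qed

text \<open>Transposition preserves the inner product and turns a right factor into a left one,
  which reduces this to \<open>mat_inner_mult_left\<close>.\<close>

lemma mat_inner_mult_right:
  assumes "A \<in> carrier_mat a b" "B \<in> carrier_mat b c" "C \<in> carrier_mat a c"
  shows "mat_inner (A * B) C = mat_inner A (C * B\<^sup>T)"
proof -
  have "mat_inner (A * B) C = mat_inner (B\<^sup>T * A\<^sup>T) C\<^sup>T"
    using assms mat_inner_transpose[of "A * B" a c C] by (simp add: transpose_mult[of _ a b _ c])
  also have "\<dots> = mat_inner A\<^sup>T (B * C\<^sup>T)"
    using assms mat_inner_mult_left[of "B\<^sup>T" c b "A\<^sup>T" a "C\<^sup>T"] by simp
  also have "B * C\<^sup>T = (C * B\<^sup>T)\<^sup>T"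
    using assms by (simp add: transpose_mult[of _ a c _ b])
  also have "mat_inner A\<^sup>T (C * B\<^sup>T)\<^sup>T = mat_inner A (C * B\<^sup>T)"
    using assms by (intro mat_inner_transpose[of _ a b]) auto
  finally show ?thesis .
qed

text \<open>Transposing both arguments preserves the value but reverses the sign of
  \<open>U\<close>, so the value equals its own negative.\<close>

lemma mat_inner_sym_skew:
  assumes "N \<in> carrier_mat k k" "U \<in> carrier_mat k k" "N\<^sup>T = N" "U\<^sup>T = - U"
  shows "mat_inner U N = 0"
proof -
  have "mat_inner U N = mat_inner (- U) N"
    using mat_inner_transpose[of U k k N] assms by simp
  also have "\<dots> = - mat_inner U N"
    using assms by (simp add: mat_inner_def sum_negf)
  finally show ?thesis by simp
qed

lemma mat_inner_add_self:
  assumes "E \<in> carrier_mat r c" "F \<in> carrier_mat r c"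
  shows "mat_inner (E + F) (E + F) = mat_inner E E + 2 * mat_inner F E + mat_inner F F"
  using assms
  by (simp add: mat_inner_def algebra_simps sum.distrib sum_distrib_left)

text \<open>\<open>K\<close> preserves inner products and the factors \<open>Q\<close> can be moved
  across, so pairing \<open>F\<close> with \<open>E\<close> amounts to pairing the skew
  \<open>U\<close> with a symmetric matrix. The result is 0 and Pythagoras applies. In the theorem
  the orthogonal matrix \<open>K\<close> is \<open>J n\<close>.\<close>

lemma frobenius_norm_le_add:
  assumes E: "E \<in> carrier_mat m m" and F: "F \<in> carrier_mat m m" and K: "K \<in> carrier_mat m m"
    and Q: "Q \<in> carrier_mat m k" and U: "U \<in> carrier_mat k k"
    and KK: "K\<^sup>T * K = 1\<^sub>m m" and KF: "K * F = Q * U * Q\<^sup>T" and skew: "U\<^sup>T = - U"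
    and sym: "(Q\<^sup>T * (K * E) * Q)\<^sup>T = Q\<^sup>T * (K * E) * Q"
  shows "frobenius_norm E \<le> frobenius_norm (E + F)"
proof -
  have "F = K\<^sup>T * (K * F)"
    using F K KK by (simp add: assoc_mult_mat[of _ m m _ m _ m, symmetric])
  then have "mat_inner F E = mat_inner (K\<^sup>T * (K * F)) E" by simp
  also have "\<dots> = mat_inner (K * F) (K * E)"
    using mat_inner_mult_left[of "K\<^sup>T" m m "K * F" m E] E F K by simp
  also have "\<dots> = mat_inner (Q * U * Q\<^sup>T) (K * E)" by (simp add: KF)
  also have "\<dots> = mat_inner (Q * U) (K * E * Q)"
    using mat_inner_mult_right[of "Q * U" m k "Q\<^sup>T" m "K * E"] E K Q U by simp
  also have "\<dots> = mat_inner U (Q\<^sup>T * (K * E * Q))"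
    using mat_inner_mult_left[of Q m k U k "K * E * Q"] E K Q U by simp
  also have "Q\<^sup>T * (K * E * Q) = Q\<^sup>T * (K * E) * Q"
    using E K Q by (simp add: assoc_mult_mat[of _ k m _ m _ k])
  also have "mat_inner U (Q\<^sup>T * (K * E) * Q) = 0"
    using E K Q U skew sym by (intro mat_inner_sym_skew[of _ k]) auto
  finally show ?thesis
    using mat_inner_add_self[OF E F] mat_inner_self_nonneg[of F] by (simp add: frobenius_norm_eq)
qed

section \<open>The pseudoinverse of a matrix with trivial kernel\<close>

text \<open>The Gram matrix of \<open>X\<close> is invertible, and its inverse times
  \<open>X\<^sup>T\<close> meets the Penrose conditions. Since \<open>pinv\<close> is a definite
  description, such a witness is needed before anything can be said about it.\<close>

lemma pinv_of_injective:
  assumes X: "X \<in> carrier_mat m k"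
    and inj: "\<And>v. v \<in> carrier_vec k \<Longrightarrow> X *\<^sub>v v = 0\<^sub>v m \<Longrightarrow> v = 0\<^sub>v k"
  shows "is_pinv X (pinv X)" "pinv X * X = 1\<^sub>m k"
proof -
  define G where "G = X\<^sup>T * X"
  have G: "G \<in> carrier_mat k k" using X by (simp add: G_def)
  \<comment> \<open>A kernel vector \<open>v\<close> of \<open>G\<close> satisfies |X v|^2 = v . G v
    = 0, so \<open>X\<close> kills it as well.\<close>
  have "det G \<noteq> 0"
  proof
    assume "det G = 0"
    then obtain v where v: "v \<in> carrier_vec k" "v \<noteq> 0\<^sub>v k" "G *\<^sub>v v = 0\<^sub>v k"
      using det_0_iff_vec_prod_zero_field[OF G] by blast
    have Xv: "X *\<^sub>v v \<in> carrier_vec m" using X v by simp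
    have "(X *\<^sub>v v) \<bullet> (X *\<^sub>v v) = v \<bullet> (X\<^sup>T *\<^sub>v (X *\<^sub>v v))"
      using transpose_vec_mult_scalar[OF X v(1) Xv] X v Xv
      by (metis comm_scalar_prod mult_mat_vec_carrier transpose_carrier_mat)
    also have "X\<^sup>T *\<^sub>v (X *\<^sub>v v) = 0\<^sub>v k" using X v by (simp add: G_def)
    finally have "(\<Sum>i<m. ((X *\<^sub>v v) $ i)\<^sup>2) = 0"
      using Xv v X by (simp add: scalar_prod_def atLeast0LessThan power2_eq_square)
    then have "X *\<^sub>v v = 0\<^sub>v m"
      using Xv X by (subst (asm) sum_nonneg_eq_0_iff) (auto intro!: eq_vecI)
    with inj v show False by blast
  qed
  then obtain B where B: "B \<in> carrier_mat k k" "B * G = 1\<^sub>m k" "G * B = 1\<^sub>m k"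
    using det_non_zero_imp_unit[OF G, of "()"] by (auto simp: Units_def ring_mat_def)
  have GT: "G\<^sup>T = G" using X by (simp add: G_def transpose_mult[of _ k m _ k])
  have "B\<^sup>T * G = 1\<^sub>m k"
    using transpose_mult[OF G B(1)] B(3) GT by simp
  \<comment> \<open>A left and a right inverse of \<open>G\<close> agree: evaluate
    \<open>B\<^sup>T * G * B\<close> in two ways.\<close>
  then have BT: "B\<^sup>T = B"
    using B G assoc_mult_mat[of "B\<^sup>T" k k G k B k] by simp
  have left: "B * X\<^sup>T * X = 1\<^sub>m k"
    using B X by (simp add: G_def assoc_mult_mat[of _ k k _ m _ k])
  \<comment> \<open>Three Penrose conditions follow from \<open>left\<close>; the symmetry of
    \<open>X * (B * X\<^sup>T)\<close> is where \<open>BT\<close> enters.\<close>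
  have "is_pinv X (B * X\<^sup>T)"
    unfolding is_pinv_def left
    using B X BT left
    by (auto simp: transpose_mult[of _ m k _ m] transpose_mult[of _ k k _ m]
        assoc_mult_mat[of _ m k _ k _ m] assoc_mult_mat[of _ m k _ m _ k])
  with left show "is_pinv X (pinv X)" "pinv X * X = 1\<^sub>m k"
    using pinv_eqI by auto
qed

section \<open>The orthogonal, skew-symmetric matrix \<open>J n\<close>\<close>

lemma J_carrier [simp]: "J n \<in> carrier_mat (2 * n) (2 * n)"
  using four_block_carrier_mat[of "0\<^sub>m n n" n n "0\<^sub>m n n" n n] by (simp add: J_def mult_2)

lemma J_dim [simp]: "dim_row (J n) = 2 * n" "dim_col (J n) = 2 * n"
  using J_carrier by blast+

lemma J_transpose: "(J n)\<^sup>T = - J n"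
  by (rule eq_matI) (auto simp: J_def)

lemma J_square: "J n * J n = - 1\<^sub>m (2 * n)"
  unfolding J_def
  by (subst mult_four_block_mat[of _ n n _ n _ n _ _ n _ n]) (auto intro!: eq_matI)

lemma J_transpose_mult: "(J n)\<^sup>T * J n = 1\<^sub>m (2 * n)"
  by (simp add: J_transpose J_square)

lemma J_mult_transpose: "J n * (J n)\<^sup>T = 1\<^sub>m (2 * n)"
  by (simp add: J_transpose J_square)

section \<open>Bases, spans and orthogonal complements\<close>

text \<open>\<open>ordered_basis\<close> treats \<open>W\<close> as a vector space of its own. Span
  and independence do not change when taken in the ambient space, because \<open>W\<close> is a
  submodule.\<close>

lemma ordered_basisD:
  assumes W: "is_subspace m W" and xs: "ordered_basis m W xs"
  shows "set xs \<subseteq> W" "W \<subseteq> carrier_vec m"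
    "module.lin_indpt class_ring (module_vec TYPE(real) m) (set xs)"
    "vec_span m (set xs) = W"
proof -
  interpret V: vec_space "TYPE(real)" m .
  have sub: "submodule class_ring W (module_vec TYPE(real) m)"
    using W by (auto simp: is_subspace_def subspace_def)
  have vs: "vectorspace class_ring (vs_on m W)"
    using W vectorspace.subspace_is_vs[OF vec_vs] by (simp add: is_subspace_def)
  have b: "LinearCombinations.module.lin_indpt class_ring (vs_on m W) (set xs)"
    "LinearCombinations.module.span class_ring (vs_on m W) (set xs) = W" "set xs \<subseteq> W"
    using xs vectorspace.basis_def[OF vs] by (auto simp: ordered_basis_def)
  show "set xs \<subseteq> W" by fact
  show "W \<subseteq> carrier_vec m"
    using sub by (simp add: submodule_def module_vec_simps)
  show "module.lin_indpt class_ring (module_vec TYPE(real) m) (set xs)"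
    "vec_span m (set xs) = W"
    using b module.span_li_not_depend[OF vec_module b(3) sub] by (auto simp: vec_span_def)
qed

lemma is_subspace_orthogonal_complement:
  assumes "Y \<subseteq> carrier_vec m"
  shows "is_subspace m (vec_module.orthogonal_complement m (Y :: real vec set))"
  using assms
  unfolding is_subspace_def subspace_def submodule_def
  by (auto simp: vec_vs vec_module module_vec_simps vec_module.orthogonal_complement_def
      add_scalar_prod_distrib[of _ m] subset_iff)

lemma orthogonal_complement_span:
  assumes "Y \<subseteq> carrier_vec m"
  shows "vec_module.orthogonal_complement m (vec_span m Y)
    = vec_module.orthogonal_complement m (Y :: real vec set)"
proof -
  interpret V: vec_space "TYPE(real)" m .
  show ?thesis using assms by (simp add: vec_span_def)
qed

text \<open>A nonzero kernel vector would be a linear dependence among the columns. Independence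
  concerns only the set of columns, so \<open>distinct xs\<close> is what excludes
  repetitions.\<close>

lemma mult_mat_vec_inj_of_independent:
  assumes "set xs \<subseteq> carrier_vec m" "distinct xs"
    and "module.lin_indpt class_ring (module_vec TYPE(real) m) (set xs)"
    and "v \<in> carrier_vec (length xs)" "mat_of_cols m xs *\<^sub>v v = 0\<^sub>v m"
  shows "v = 0\<^sub>v (length xs)"
proof -
  interpret V: vec_space "TYPE(real)" m .
  show ?thesis
    using V.lin_depI[of "mat_of_cols m xs" "length xs" v] assms by (auto simp: cols_mat_of_cols)
qed


text \<open>
  The premises mention dimensions only, so that the simplifier need not guess the intermediate
  dimensions of products, as it must with the carrier-based versions.
\<close>

lemma
  fixes A B C :: "real mat"
  shows assoc_mult_mat_dim:
      "dim_col A = dim_row B \<Longrightarrow> dim_col B = dim_row C \<Longrightarrow> A * B * C = A * (B * C)"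
    and mult_add_mat_dim:
      "dim_col A = dim_row B \<Longrightarrow> dim_row B = dim_row C \<Longrightarrow> dim_col B = dim_col C \<Longrightarrow>
        A * (B + C) = A * B + A * C"
    and add_mult_mat_dim:
      "dim_row A = dim_row B \<Longrightarrow> dim_col A = dim_col B \<Longrightarrow> dim_col B = dim_row C \<Longrightarrow>
        (A + B) * C = A * C + B * C"
    and mult_minus_mat_dim:
      "dim_col A = dim_row B \<Longrightarrow> dim_row B = dim_row C \<Longrightarrow> dim_col B = dim_col C \<Longrightarrow>
        A * (B - C) = A * B - A * C"
    and minus_mult_mat_dim:
      "dim_row A = dim_row B \<Longrightarrow> dim_col A = dim_col B \<Longrightarrow> dim_col B = dim_row C \<Longrightarrow>
        (A - B) * C = A * C - B * C"
    and transpose_mult_dim: "dim_col A = dim_row B \<Longrightarrow> (A * B)\<^sup>T = B\<^sup>T * A\<^sup>T"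
    and transpose_add_dim:
      "dim_row A = dim_row B \<Longrightarrow> dim_col A = dim_col B \<Longrightarrow> (A + B)\<^sup>T = A\<^sup>T + B\<^sup>T"
    and transpose_minus_dim:
      "dim_row A = dim_row B \<Longrightarrow> dim_col A = dim_col B \<Longrightarrow> (A - B)\<^sup>T = A\<^sup>T - B\<^sup>T"
    and one_mult_mat_dim: "dim_row A = k \<Longrightarrow> 1\<^sub>m k * A = A"
    and mult_one_mat_dim: "dim_col A = k \<Longrightarrow> A * 1\<^sub>m k = A"
  by (auto intro!: eq_matI assoc_mult_mat[of _ "dim_row A" "dim_col A" _ "dim_col B" _ "dim_col C"]
      add_mult_distrib_mat mult_add_distrib_mat minus_mult_distrib_mat mult_minus_distrib_mat
      transpose_mult transpose_add transpose_minus)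

lemmas mat_dim_simps = assoc_mult_mat_dim mult_add_mat_dim add_mult_mat_dim
  mult_minus_mat_dim minus_mult_mat_dim transpose_mult_dim transpose_add_dim transpose_minus_dim
  one_mult_mat_dim mult_one_mat_dim

section \<open>The projector onto the orthogonal complement\<close>

text \<open>Both \<open>Q * Q\<^sup>T\<close> and \<open>1\<^sub>m m - X * P\<close> project
  orthogonally onto the complement of the column space of \<open>X\<close>. They agree because their
  product equals each of them.\<close>

lemma orthonormal_basis_projection:
  assumes X: "X \<in> carrier_mat m k" and P: "is_pinv X P" and Q: "Q \<in> carrier_mat m q"
    and onb: "orthonormal_basis m
      (vec_module.orthogonal_complement m (vec_span m (set (cols X)))) (cols Q)"
  shows "Q\<^sup>T * Q = 1\<^sub>m q" "Q\<^sup>T * X = 0\<^sub>m q k" "Q * Q\<^sup>T = 1\<^sub>m m - X * P"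
proof -
  interpret V: vec_space "TYPE(real)" m .
  let ?W = "vec_module.orthogonal_complement m (set (cols X))"
  have cols: "set (cols X) \<subseteq> carrier_vec m" using X cols_dim[of X] by auto
  have b: "ordered_basis m ?W (cols Q)"
    and on: "\<And>i j. i < q \<Longrightarrow> j < q \<Longrightarrow> cols Q ! i \<bullet> cols Q ! j = (if i = j then 1 else 0)"
    using onb Q by (simp_all add: orthogonal_complement_span[OF cols] orthonormal_basis_def)
  note W = ordered_basisD[OF is_subspace_orthogonal_complement[OF cols] b]
  have Pc: "P \<in> carrier_mat k m" and XPX: "X * P * X = X" and XP: "(X * P)\<^sup>T = X * P"
    using P X by (auto simp: is_pinv_def)
  show QQ: "Q\<^sup>T * Q = 1\<^sub>m q"
    using Q on by (auto intro!: eq_matI)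
  have "col Q i \<bullet> col X j = 0" if "i < q" "j < k" for i j
  proof -
    have "col Q i \<in> ?W"
      using W(1) Q that by (auto simp: cols_def)
    then show ?thesis
      using X that by (auto simp: V.orthogonal_complement_def cols_def)
  qed
  then show QX: "Q\<^sup>T * X = 0\<^sub>m q k"
    using Q X by (auto intro!: eq_matI)
  define R where "R = 1\<^sub>m m - X * P"
  have R: "R \<in> carrier_mat m m" using X Pc by (auto simp: R_def intro!: carrier_matI)
  have "R * X = 0\<^sub>m m k"
    using X Pc XPX by (simp add: R_def minus_mult_mat_dim)
  moreover have "R\<^sup>T = R"
    using X Pc XP by (simp add: R_def transpose_minus_dim)
  ultimately have XR: "X\<^sup>T * R = 0\<^sub>m k m"
    using X R by (metis transpose_mult zero_transpose_mat)
  \<comment> \<open>By \<open>XR\<close> each column of \<open>R\<close> lies in the complement, so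
    it is \<open>Q *\<^sub>v c\<close> for some \<open>c\<close>, and \<open>QQ\<close> shows that
    \<open>Q * Q\<^sup>T\<close> fixes such vectors.\<close>
  have "Q * (Q\<^sup>T * R) = R"
  proof (rule mat_col_eqI)
    fix j assume "j < dim_col R"
    then have j: "j < m" using R by simp
    have Rj: "col R j \<in> carrier_vec m" using R by auto
    have "col R j \<bullet> col X i = 0" if "i < k" for i
      using arg_cong[OF XR, of "\<lambda>M. M $$ (i, j)"] X R j that
        comm_scalar_prod[of "col X i" m "col R j"] by auto
    then have "col R j \<in> ?W"
      using X Rj by (auto simp: V.orthogonal_complement_def cols_def)
    also have "?W = V.col_space Q"
      using W(4) by (simp add: vec_span_def V.col_space_def)
    finally obtain c where c: "c \<in> carrier_vec q" "col R j = Q *\<^sub>v c"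
      using V.col_space_eq[OF Q] Q by auto
    have "col (Q * (Q\<^sup>T * R)) j = Q *\<^sub>v (Q\<^sup>T *\<^sub>v col R j)"
      using col_mult2[of Q m q "Q\<^sup>T * R" m j] col_mult2[of "Q\<^sup>T" q m R m j] Q R j
      by (metis mult_carrier_mat transpose_carrier_mat)
    also have "Q\<^sup>T *\<^sub>v col R j = (Q\<^sup>T * Q) *\<^sub>v c"
      using c Q by (simp add: assoc_mult_mat_vec[of _ q m _ q] del: QQ)
    finally show "col (Q * (Q\<^sup>T * R)) j = col R j"
      using c QQ by simp
  qed (use Q R in auto)
  \<comment> \<open>Here \<open>QX\<close> removes the term \<open>X * P\<close> of
    \<open>R\<close>.\<close>
  moreover have "Q * (Q\<^sup>T * R) = Q * Q\<^sup>T"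
  proof -
    have "Q\<^sup>T * R = Q\<^sup>T - Q\<^sup>T * X * P"
      using Q X Pc by (simp add: R_def mat_dim_simps)
    also have "\<dots> = Q\<^sup>T" using Q X Pc by (auto simp: QX intro!: eq_matI)
    finally show ?thesis by simp
  qed
  ultimately show "Q * Q\<^sup>T = 1\<^sub>m m - X * P" by (simp add: R_def)
qed

section \<open>Skew-Hamiltonian and skew-symmetric matrices\<close>

text \<open>Multiplying the defining identity by \<open>J n\<close> gives
  \<open>J n * H = H\<^sup>T * J n\<close>; the minus sign then comes from transposing
  \<open>J n\<close>.\<close>

lemma skew_hamiltonian_transpose_J_mult:
  assumes "skew_hamiltonian n H"
  shows "(J n * H)\<^sup>T = - (J n * H)"
proof -
  have H: "H \<in> carrier_mat (2 * n) (2 * n)" "(J n)\<^sup>T * H\<^sup>T * J n = H"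
    using assms by (auto simp: skew_hamiltonian_def)
  have "J n * H = (J n * (J n)\<^sup>T) * (H\<^sup>T * J n)"
    using H by (simp add: assoc_mult_mat_dim)
  then have "J n * H = H\<^sup>T * J n"
    using H by (simp add: J_mult_transpose one_mult_mat_dim)
  then show ?thesis
    using H by (simp add: transpose_mult_dim J_transpose)
qed

text \<open>Sending \<open>W\<close> to \<open>(J n)\<^sup>T * W\<^sup>T * J n\<close> is a linear
  involution, since \<open>J n\<close> squares to minus the identity, so \<open>W\<close> plus its
  image is fixed. \<open>Hhat\<close> has this form.\<close>

lemma skew_hamiltonian_symmetrization:
  assumes W: "W \<in> carrier_mat (2 * n) (2 * n)"
  shows "skew_hamiltonian n (W + (J n)\<^sup>T * W\<^sup>T * J n)"
proof -
  have "(J n)\<^sup>T * ((J n)\<^sup>T * W\<^sup>T * J n)\<^sup>T * J n = ((J n)\<^sup>T * (J n)\<^sup>T) * W * (J n * J n)"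
    using W by (simp add: assoc_mult_mat_dim transpose_mult_dim)
  also have "\<dots> = W"
    using W by (simp add: J_transpose J_square mat_dim_simps)
  finally have *: "(J n)\<^sup>T * ((J n)\<^sup>T * W\<^sup>T * J n)\<^sup>T * J n = W" .
  have "(J n)\<^sup>T * W\<^sup>T * J n \<in> carrier_mat (2 * n) (2 * n)"
    using W by (intro carrier_matI) auto
  with W comm_add_mat[OF this W] * show ?thesis
    by (simp add: skew_hamiltonian_def transpose_add_dim mult_add_mat_dim add_mult_mat_dim)
qed

text \<open>Transposing \<open>KQ\<close> and using skewness gives
  \<open>Q * Q\<^sup>T * K = K\<close>, so \<open>Q * Q\<^sup>T\<close> can be inserted on both
  sides of \<open>K\<close>.\<close>

lemma skew_eq_compression:
  fixes K Q :: "real mat"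
  assumes K: "K \<in> carrier_mat m m" "K\<^sup>T = - K" and Q: "Q \<in> carrier_mat m q"
    and KQ: "K * (Q * Q\<^sup>T) = K"
  shows "K = Q * (Q\<^sup>T * K * Q) * Q\<^sup>T"
proof -
  have "(Q * Q\<^sup>T * K)\<^sup>T = - (K * (Q * Q\<^sup>T))"
    using K Q by (simp add: transpose_mult_dim assoc_mult_mat_dim)
  also have "\<dots> = K\<^sup>T" using KQ K by simp
  finally have "Q * Q\<^sup>T * K = K" by (metis transpose_transpose)
  with KQ have "K = Q * Q\<^sup>T * K * (Q * Q\<^sup>T)" by simp
  then show ?thesis using K Q by (simp add: assoc_mult_mat_dim)
qed

lemma skew_transpose_congruence:
  fixes K Q :: "real mat"
  assumes K: "K \<in> carrier_mat m m" "K\<^sup>T = - K" and Q: "Q \<in> carrier_mat m q"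
  shows "(Q\<^sup>T * K * Q)\<^sup>T = - (Q\<^sup>T * K * Q)"
  using assms by (simp add: transpose_mult_dim assoc_mult_mat_dim)

lemma minus_add_minus_cancel_mat:
  fixes A B C :: "real mat"
  assumes "A \<in> carrier_mat r c" "B \<in> carrier_mat r c" "C \<in> carrier_mat r c"
  shows "(B - A) + (C - B) = C - A"
  using assms by (intro eq_matI) auto

section \<open>Comparison of \<open>H\<close> with the elements of \<open>HK n xs\<close>\<close>

theorem lemma3:
  fixes n :: nat and A H Hhat S XL XR Q :: "real mat"
    and L :: "real vec set" and xs :: "real vec list"
  assumes "n \<ge> 1"
    and "A \<in> carrier_mat (2 * n) (2 * n)"
    and "lagrangian n L"
    and "length xs = n" and "ordered_basis (2 * n) L xs"
    and "XL = mat_of_cols (2 * n) (butlast xs)"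
    and "XR = mat_of_cols (2 * n) (tl xs)"
    and "Hhat = XR * pinv XL + (J n)\<^sup>T * (XR * pinv XL)\<^sup>T * J n"
    and "Q \<in> carrier_mat (2 * n) (n + 1)"
    and "orthonormal_basis (2 * n)
           (vec_module.orthogonal_complement (2 * n) (vec_span (2 * n) (set (butlast xs))))
           (cols Q)"
    and "S = (- (1 / 2)) \<cdot>\<^sub>m (Q\<^sup>T * J n * (Hhat - A) * Q + Q\<^sup>T * (Hhat - A)\<^sup>T * J n * Q)"
    and "H = Hhat + (J n)\<^sup>T * Q * S * Q\<^sup>T"
  shows "\<forall>H' \<in> HK n xs. frobenius_norm (H - A) \<le> frobenius_norm (H' - A)"
proof
  fix H' assume "H' \<in> HK n xs"
  then have H': "H' \<in> carrier_mat (2 * n) (2 * n)" and skewH': "skew_hamiltonian n H'"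
    and H'xs: "\<And>k. Suc k < n \<Longrightarrow> H' *\<^sub>v (xs ! k) = xs ! Suc k"
    using assms(4) by (auto simp: HK_def skew_hamiltonian_def)
  note A = assms(2) and Q = assms(9) and XL_def = assms(6) and XR_def = assms(7)
    and S_def = assms(11) and H_def = assms(12)
  have sub: "is_subspace (2 * n) L" and iso: "\<And>x y. x \<in> L \<Longrightarrow> y \<in> L \<Longrightarrow> x \<bullet> (J n *\<^sub>v y) = 0"
    using assms(3) by (auto simp: lagrangian_def isotropic_def)
  note basis = ordered_basisD[OF sub assms(5)]
  have dist: "distinct xs" using assms(5) by (simp add: ordered_basis_def)
  have butlast: "set (butlast xs) \<subseteq> carrier_vec (2 * n)" "distinct (butlast xs)"
    using basis(1,2) dist in_set_butlastD[of _ xs] by (auto simp: distinct_butlast)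
  have colsXL: "cols XL = butlast xs"
    using butlast by (simp add: XL_def)
  have XL: "XL \<in> carrier_mat (2 * n) (n - 1)" and XR: "XR \<in> carrier_mat (2 * n) (n - 1)"
    using assms(4) by (auto simp: XL_def XR_def intro: mat_of_cols_carrier)
  \<comment> \<open>Indices start at 0: the columns \<open>j\<close> of \<open>XL\<close> and
    \<open>XR\<close> are consecutive basis vectors. For \<open>n = 1\<close> there are no
    columns.\<close>
  have colXL: "col XL j = xs ! j" and colXR: "col XR j = xs ! Suc j"
    and xsL: "xs ! j \<in> L" "xs ! Suc j \<in> L"
    if "j < n - 1" for j
    using that assms(4) basis(1,2)
    by (auto simp: XL_def XR_def col_mat_of_cols nth_butlast nth_tl subset_iff)
  interpret V: vec_space "TYPE(real)" "2 * n" .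
  have indep: "module.lin_indpt class_ring (module_vec TYPE(real) (2 * n)) (set (butlast xs))"
    using basis(3) V.supset_ld_is_ld[of "set (butlast xs)" "set xs"] in_set_butlastD[of _ xs]
    by auto
  define P where "P = pinv XL"
  have pinv: "is_pinv XL P" and PXL: "P * XL = 1\<^sub>m (n - 1)"
    using pinv_of_injective[OF XL] mult_mat_vec_inj_of_independent[OF butlast indep] assms(4)
    by (auto simp: P_def XL_def)
  have P: "P \<in> carrier_mat (n - 1) (2 * n)"
    using pinv XL by (simp add: is_pinv_def)
  note proj = orthonormal_basis_projection[OF XL pinv Q, unfolded colsXL, OF assms(10)]
  define W where "W = XR * P"
  have W: "W \<in> carrier_mat (2 * n) (2 * n)" using XR P by (simp add: W_def)
  have Hhat_def: "Hhat = W + (J n)\<^sup>T * W\<^sup>T * J n"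
    using assms(8) by (simp add: W_def P_def)
  have skewHhat: "skew_hamiltonian n Hhat"
    unfolding Hhat_def using W by (rule skew_hamiltonian_symmetrization)
  then have Hhat: "Hhat \<in> carrier_mat (2 * n) (2 * n)"
    by (simp add: skew_hamiltonian_def)
  \<comment> \<open>Each entry pairs two basis vectors through \<open>J n\<close> and vanishes by
    isotropy.\<close>
  have XRJXL: "XR\<^sup>T * (J n * XL) = 0\<^sub>m (n - 1) (n - 1)"
  proof (rule eq_matI, goal_cases)
    case (1 i j)
    then show ?case
      using XR XL iso xsL[of i] xsL[of j] colXL[of j] colXR[of i]
      by (simp add: col_mult2[OF J_carrier XL])
  qed (use XR XL in auto)
  \<comment> \<open>\<open>P * XL\<close> is the identity and \<open>XRJXL\<close> kills the second
    summand, so \<open>Hhat\<close> meets the same interpolation conditions as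
    \<open>H'\<close>.\<close>
  have HhatXL: "Hhat * XL = XR"
  proof -
    have "Hhat * XL = XR * (P * XL) + (J n)\<^sup>T * (P\<^sup>T * (XR\<^sup>T * (J n * XL)))"
      using P XR XL
      by (simp add: Hhat_def W_def add_mult_mat_dim assoc_mult_mat_dim transpose_mult_dim)
    then show ?thesis
      using P XR by (simp add: PXL XRJXL)
  qed
  have H'XL: "H' * XL = XR"
  proof (rule mat_col_eqI)
    fix j assume "j < dim_col XR"
    then have j: "j < n - 1" using XR by simp
    then have "col (H' * XL) j = H' *\<^sub>v (xs ! j)"
      using col_mult2[OF H' XL j] colXL by metis
    then show "col (H' * XL) j = col XR j"
      using H'xs[of j] colXR[OF j] j by simp
  qed (use XR XL H' in auto)
  define K where "K = J n * (H' - Hhat)"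
  have K: "K \<in> carrier_mat (2 * n) (2 * n)"
    using Hhat by (auto simp: K_def intro!: carrier_matI)
  have KT: "K\<^sup>T = - K"
  proof -
    have "K\<^sup>T = (J n * H')\<^sup>T - (J n * Hhat)\<^sup>T"
      using H' Hhat by (simp add: K_def mult_minus_mat_dim transpose_minus_dim)
    also have "\<dots> = - (J n * H') - - (J n * Hhat)"
      by (simp add: skew_hamiltonian_transpose_J_mult[OF skewH']
          skew_hamiltonian_transpose_J_mult[OF skewHhat])
    also have "\<dots> = - K"
      using H' Hhat by (auto simp: K_def mult_minus_mat_dim intro!: eq_matI)
    finally show ?thesis .
  qed
  \<comment> \<open>Both \<open>H'\<close> and \<open>Hhat\<close> map \<open>XL\<close> to
    \<open>XR\<close>.\<close>
  have "K * XL = 0\<^sub>m (2 * n) (n - 1)"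
    using H' Hhat XL XR
    by (simp add: K_def assoc_mult_mat_dim minus_mult_mat_dim HhatXL H'XL)
  then have "K * (XL * P) = 0\<^sub>m (2 * n) (2 * n)"
    using K XL P by (simp add: assoc_mult_mat_dim[symmetric])
  \<comment> \<open>As \<open>K\<close> kills \<open>XL * P\<close>, multiplying it by the
    complementary projector changes nothing.\<close>
  then have KQQ: "K * (Q * Q\<^sup>T) = K"
    using K XL P by (auto simp: proj(3) mult_minus_mat_dim mult_one_mat_dim intro!: eq_matI)
  define T where "T = Q\<^sup>T * K * Q"
  have T: "T \<in> carrier_mat (n + 1) (n + 1)" and TT: "T\<^sup>T = - T"
    using K Q skew_transpose_congruence[OF K KT Q] by (auto simp: T_def)
  have K_eq: "K = Q * T * Q\<^sup>T"
    using skew_eq_compression[OF K KT Q KQQ] by (simp add: T_def)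
  define M where "M = Q\<^sup>T * (J n * (Hhat - A)) * Q"
  have M: "M \<in> carrier_mat (n + 1) (n + 1)"
    using Q A by (auto simp: M_def intro!: carrier_matI)
  \<comment> \<open>Skewness of \<open>J n\<close> turns the plus sign in the formula for
    \<open>S\<close> into a minus: \<open>S\<close> is minus the skew part of
    \<open>M\<close>.\<close>
  have S_eq: "S = (- (1 / 2)) \<cdot>\<^sub>m (M - M\<^sup>T)"
  proof -
    have "M\<^sup>T = - (Q\<^sup>T * (Hhat - A)\<^sup>T * J n * Q)"
      using Q A by (simp add: M_def transpose_mult_dim assoc_mult_mat_dim J_transpose)
    moreover have "Q\<^sup>T * J n * (Hhat - A) * Q = M"
      using Q A by (simp add: M_def assoc_mult_mat_dim)
    ultimately show ?thesis
      using Q A M by (auto simp: S_def intro!: eq_matI)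
  qed
  have S: "S \<in> carrier_mat (n + 1) (n + 1)" and ST: "S\<^sup>T = - S"
    using M by (auto simp: S_eq diff_divide_distrib intro!: eq_matI)
  have H: "H \<in> carrier_mat (2 * n) (2 * n)"
    using Hhat Q by (auto simp: H_def intro!: carrier_matI)
  have "frobenius_norm (H - A) \<le> frobenius_norm ((H - A) + (H' - H))"
  proof (rule frobenius_norm_le_add[where K = "J n" and Q = Q and U = "T - S"])
    \<comment> \<open>The correction term of \<open>H\<close> carries the factor
      \<open>(J n)\<^sup>T\<close>, which \<open>J n\<close> cancels; this serves both
      \<open>J n * (H' - H)\<close> and \<open>J n * (H - A)\<close>.\<close>
    have QSQ: "J n * (J n)\<^sup>T * (Q * S * Q\<^sup>T) = Q * S * Q\<^sup>T"
      using Q S by (simp add: J_mult_transpose one_mult_mat_dim)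
    have "H' - H = (H' - Hhat) - (J n)\<^sup>T * (Q * S * Q\<^sup>T)"
      using H' Hhat Q S by (auto simp: H_def assoc_mult_mat_dim intro!: eq_matI)
    then have "J n * (H' - H) = K - J n * (J n)\<^sup>T * (Q * S * Q\<^sup>T)"
      using H' Hhat Q S by (simp add: K_def mult_minus_mat_dim assoc_mult_mat_dim)
    then show "J n * (H' - H) = Q * (T - S) * Q\<^sup>T"
      using Q T S by (simp add: QSQ K_eq mult_minus_mat_dim minus_mult_mat_dim)
    show "(T - S)\<^sup>T = - (T - S)"
      using T S by (auto simp: transpose_minus_dim TT ST intro!: eq_matI)
    have "H - A = (Hhat - A) + (J n)\<^sup>T * (Q * S * Q\<^sup>T)"
      using A Hhat Q S by (auto simp: H_def assoc_mult_mat_dim intro!: eq_matI)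
    then have "J n * (H - A) = J n * (Hhat - A) + J n * (J n)\<^sup>T * (Q * S * Q\<^sup>T)"
      using A Hhat Q S by (simp add: mult_add_mat_dim assoc_mult_mat_dim)
    then have "J n * (H - A) = J n * (Hhat - A) + Q * S * Q\<^sup>T"
      by (simp only: QSQ)
    then have "Q\<^sup>T * (J n * (H - A)) * Q = M + (Q\<^sup>T * Q) * S * (Q\<^sup>T * Q)"
      using Q A S by (simp add: M_def mult_add_mat_dim add_mult_mat_dim assoc_mult_mat_dim)
    \<comment> \<open>\<open>M + S\<close> is half of \<open>M + M\<^sup>T\<close>: the choice of
      \<open>S\<close> leaves exactly the symmetric part of \<open>M\<close>.\<close>
    also have "\<dots> = M + S" using S by (simp add: proj(1))
    finally show "(Q\<^sup>T * (J n * (H - A)) * Q)\<^sup>T = Q\<^sup>T * (J n * (H - A)) * Q"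
      using M by (intro eq_matI) (auto simp: S_eq field_simps)
  qed (use A H H' Q T S J_transpose_mult in \<open>auto intro!: carrier_matI\<close>)
  then show "frobenius_norm (H - A) \<le> frobenius_norm (H' - A)"
    by (simp add: minus_add_minus_cancel_mat[OF A H H'])
qed

end
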